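(* Let $\{\phi^t\}$ be an $\mathcal{R}$-flow on $P$. Then $\{\phi^t\}$ is topologically conjugate to the standard Reeb flow $\{\Phi^t\}$ if and only if, for every $\lambda>0$, the flow $\{\phi^{\lambda t}\}$ is topologically conjugate to $\{\phi^t\}$.
   Context: Let $P=\{(\xi,\eta)\in\mathbb{R}^2\mid \xi\ge 0,\ \eta\ge 0\}\setminus\{(0,0)\}$. The standard Reeb flow is the flow $\{\Phi^t\}_{t\in\mathbb{R}}$ on $P$ given by $\Phi^t(\xi,\eta)=(e^t\xi,e^{-t}\eta)$. The Reeb foliation $\mathcal{R}$ is the oriented foliation of $P$ whose leaves are the orbits of $\{\Phi^t\}$, oriented by the time direction. An $\mathcal{R}$-flow is a continuous flow $\{\phi^t\}_{t\in\mathbb{R}}$ on $P$ whose (oriented) orbit foliation is $\mathcal{R}$, i.e. its orbits are exactly the orbits of $\{\Phi^t\}$, traversed in the same direction (in particular it has no fixed points). Two flows $\{\phi^t\}$ and $\{\psi^t\}$ on $P$ are topologically conjugate if there is a homeomorphism $g:P\to P$ with $g\circ\phi^t=\psi^t\circ g$ for all $t\in\mathbb{R}$. For $\lambda>0$, $\{\phi^{\lambda t}\}$ denotes the flow whose time-$t$ map is $\phi^{\lambda t}$. *)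

theory Defs
  imports "HOL-Analysis.Analysis"
begin

definition reeb_space :: "(real \<times> real) set" where
  "reeb_space = {(x, y). x \<ge> 0 \<and> y \<ge> 0} - {(0, 0)}"

definition reeb_flow :: "real \<Rightarrow> real \<times> real \<Rightarrow> real \<times> real" where
  "reeb_flow t p = (exp t * fst p, exp (- t) * snd p)"

(* Time-t maps are total functions on the ambient type; their values outside S are irrelevant. *)
definition continuous_flow_on :: "'a::topological_space set \<Rightarrow> (real \<Rightarrow> 'a \<Rightarrow> 'a) \<Rightarrow> bool" where
  "continuous_flow_on S \<phi> \<longleftrightarrow>
     continuous_on (UNIV \<times> S) (\<lambda>(t, p). \<phi> t p) \<and>
     (\<forall>t. \<forall>p\<in>S. \<phi> t p \<in> S) \<and>
     (\<forall>p\<in>S. \<phi> 0 p = p) \<and>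
     (\<forall>s t. \<forall>p\<in>S. \<phi> (s + t) p = \<phi> s (\<phi> t p))"

definition flow_orbit :: "(real \<Rightarrow> 'a \<Rightarrow> 'a) \<Rightarrow> 'a \<Rightarrow> 'a set" where
  "flow_orbit \<phi> p = range (\<lambda>t. \<phi> t p)"

definition flow_orbits :: "'a set \<Rightarrow> (real \<Rightarrow> 'a \<Rightarrow> 'a) \<Rightarrow> 'a set set" where
  "flow_orbits S \<phi> = flow_orbit \<phi> ` S"

(* The last conjunct is the agreement of orientations: moving forward along \<phi> is moving
   forward along the standard flow. Since the standard flow has no periodic points, this also
   excludes fixed points of \<phi>. *)
definition reeb_foliation_flow :: "(real \<Rightarrow> real \<times> real \<Rightarrow> real \<times> real) \<Rightarrow> bool" where
  "reeb_foliation_flow \<phi> \<longleftrightarrow>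
     continuous_flow_on reeb_space \<phi> \<and>
     flow_orbits reeb_space \<phi> = flow_orbits reeb_space reeb_flow \<and>
     (\<forall>p\<in>reeb_space. \<forall>t>0. \<exists>s>0. \<phi> t p = reeb_flow s p)"

definition topologically_conjugate_on ::
  "'a::topological_space set \<Rightarrow> (real \<Rightarrow> 'a \<Rightarrow> 'a) \<Rightarrow> (real \<Rightarrow> 'a \<Rightarrow> 'a) \<Rightarrow> bool" where
  "topologically_conjugate_on S \<phi> \<psi> \<longleftrightarrow>
     (\<exists>g h. homeomorphism S S g h \<and> (\<forall>t. \<forall>p\<in>S. g (\<phi> t p) = \<psi> t (g p)))"

end

theory Submission
  imports Defs
begin

text \<open>
  The conjugacy class of a flow with the Reeb foliation is governed by its transit time \<open>f x\<close> from
  \<open>(x, 1)\<close> to \<open>(1, x)\<close>, which tends to infinity as \<open>x\<close> tends to 0: two flows are conjugate iff, up to a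
  reparametrization of \<open>x\<close>, their transit times differ by a function converging at 0. As the standard
  flow has transit time \<open>- ln x\<close>, a flow is conjugate to it iff \<open>f\<close> is strictly monotone up to a
  convergent function.

  If all rescalings of the flow are conjugate to it, then \<open>F s = f (exp (- s))\<close> satisfies
  \<open>F \<circ> H\<^sub>l = l * F + convergent\<close> with an increasing \<open>H\<^sub>l\<close> for every \<open>l\<close>. The case \<open>l = 2\<close> alone
  turns \<open>F\<close> into the exactly self-similar \<open>M s = lim F (h\<^sup>k s) / 2\<^sup>k\<close> with \<open>h = H\<^sub>2\<close>, and \<open>F - M\<close>
  converges. Suppose that \<open>M\<close> drops from a running maximum \<open>\<alpha> > 0\<close> to \<open>\<beta> < \<alpha>\<close>. Conjugating
  \<open>H\<^sub>l\<close> with a high power of \<open>h\<close> makes its error negligible, so that \<open>M\<close> also drops from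
  about \<open>l * \<alpha>\<close> to about \<open>l * \<beta>\<close>, within a compact interval independent of \<open>l\<close>. These drops are
  disjoint for different \<open>l\<close>, so there are arbitrarily many of them in a compact interval, which
  is absurd. Hence \<open>M\<close> is eventually monotone.
\<close>

section \<open>Asymptotically self-similar functions\<close>

text \<open>Take \<open>K + 1\<close> equally spaced factors \<open>l\<close> in
  \<open>[1, 2]\<close>. As \<open>l * \<alpha>\<close> is almost a running maximum up to the end of
  its drop, the drop of a larger factor starts only after that of a smaller one has ended. Uniform
  continuity makes each drop at least \<eta> long, too long in total for
  \<open>{0..q}\<close>.\<close>

lemma no_scalable_drop:
  fixes F :: "real \<Rightarrow> real"
  assumes cont: "continuous_on UNIV F" and lim: "filterlim F at_top at_top"
    and scale: "\<And>l e. 1 \<le> l \<Longrightarrow> l \<le> 2 \<Longrightarrow> e > 0 \<Longrightarrow>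
      \<exists>a b. 0 \<le> a \<and> a \<le> b \<and> F a \<ge> l * \<alpha> - e \<and> F b \<le> l * \<beta> + e \<and> (\<forall>t\<in>{0..b}. F t \<le> l * \<alpha> + e)"
    and \<alpha>: "\<alpha> > 0" and drop: "\<beta> < \<alpha>"
  shows False
proof -
  define d where "d = \<alpha> - \<beta>"
  have d: "d > 0" using drop by (simp add: d_def)
  \<comment> \<open>All drops end before \<open>q\<close>: up to its end a drop stays below
    \<open>l * \<alpha> + e\<close>, hence below \<open>2 * \<alpha> + 1\<close>.\<close>
  obtain q where q: "q \<ge> 0" "F q > 2 * \<alpha> + 1"
  proof -
    have "eventually (\<lambda>x. F x > 2 * \<alpha> + 1 \<and> x \<ge> 0) at_top"
      using lim by (auto intro!: eventually_conj simp: filterlim_at_top_dense eventually_ge_at_top)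
    then obtain N where "\<forall>n\<ge>N. F n > 2 * \<alpha> + 1 \<and> n \<ge> 0" unfolding eventually_at_top_linorder by blast
    then show ?thesis using that[of N] by auto
  qed
  have "uniformly_continuous_on {0..q} F"
    using compact_uniformly_continuous[of "{0..q}" F] cont continuous_on_subset by blast
  then obtain \<eta> where \<eta>: "\<eta> > 0" "\<And>x y. x \<in> {0..q} \<Longrightarrow> y \<in> {0..q} \<Longrightarrow> dist y x < \<eta> \<Longrightarrow> dist (F y) (F x) < d / 2"
    using d unfolding uniformly_continuous_on_def by (metis half_gt_zero)
  obtain K0 :: nat where K0: "real K0 * \<eta> > q" using \<eta>(1) reals_Archimedean3 by blast
  define K where "K = Suc K0"
  have K: "real K * \<eta> > q" "K > 0"
    using K0 \<eta>(1) unfolding K_def by (auto simp: distrib_right)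
  \<comment> \<open>The bound 1 keeps the drops left of \<open>q\<close>, \<open>d / 4\<close>
    leaves each a height of at least \<open>d / 2\<close>, and the last bound keeps the errors below
    the spacing \<open>\<alpha> / K\<close> of consecutive levels.\<close>
  define e where "e = min 1 (min (d / 4) (\<alpha> / (4 * real K)))"
  have e: "e > 0" "e \<le> 1" "e \<le> d / 4" "e \<le> \<alpha> / (4 * real K)"
    unfolding e_def using d \<alpha> K(2) by (auto intro: min.coboundedI2)
  define l where "l j = 1 + real j / real K" for j
  have l: "1 \<le> l j" "l j \<le> 2" if "j \<le> K" for j using that K by (auto simp: l_def divide_simps)
  have "\<forall>j. \<exists>p. j \<le> K \<longrightarrow> 0 \<le> fst p \<and> fst p \<le> snd p \<and> F (fst p) \<ge> l j * \<alpha> - e \<and>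
      F (snd p) \<le> l j * \<beta> + e \<and> (\<forall>t\<in>{0..snd p}. F t \<le> l j * \<alpha> + e)"
    using scale[OF l e(1)] by (metis fst_conv snd_conv)
  then obtain p where p: "\<And>j. j \<le> K \<Longrightarrow> 0 \<le> fst (p j) \<and> fst (p j) \<le> snd (p j) \<and>
      F (fst (p j)) \<ge> l j * \<alpha> - e \<and> F (snd (p j)) \<le> l j * \<beta> + e \<and> (\<forall>t\<in>{0..snd (p j)}. F t \<le> l j * \<alpha> + e)"
    by metis
  have le_q: "snd (p j) \<le> q" if "j \<le> K" for j
  proof (rule ccontr)
    assume "\<not> snd (p j) \<le> q"
    then have "F q \<le> l j * \<alpha> + e" using p[OF that] q by auto
    moreover have "l j * \<alpha> \<le> 2 * \<alpha>" using l[OF that] \<alpha> by simp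
    ultimately show False using q e by linarith
  qed
  have gap: "snd (p j) \<ge> fst (p j) + \<eta>" if "j \<le> K" for j
  proof (rule ccontr)
    assume "\<not> snd (p j) \<ge> fst (p j) + \<eta>"
    then have "dist (F (snd (p j))) (F (fst (p j))) < d / 2"
      using p[OF that] le_q[OF that] by (intro \<eta>(2)) (auto simp: dist_real_def)
    then have "F (fst (p j)) - F (snd (p j)) < d / 2" unfolding dist_real_def by linarith
    moreover have "l j * d \<ge> d" using l[OF that] d by simp
    moreover have "l j * d = l j * \<alpha> - l j * \<beta>" by (simp add: d_def right_diff_distrib)
    ultimately show False using p[OF that] e by linarith
  qed
  txt \<open>The next drop starts above everything that \<open>F\<close> attains up to the end of the previous one.\<close>
  have step: "fst (p (Suc j)) \<ge> snd (p j)" if "Suc j \<le> K" for j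
  proof (rule ccontr)
    assume "\<not> fst (p (Suc j)) \<ge> snd (p j)"
    then have "F (fst (p (Suc j))) \<le> l j * \<alpha> + e" using p[of j] p[of "Suc j"] that by auto
    moreover have "l (Suc j) * \<alpha> = l j * \<alpha> + \<alpha> / K" by (simp add: l_def algebra_simps add_divide_distrib)
    moreover have "\<alpha> / K > 0" using \<alpha> K by simp
    moreover have "\<alpha> / (4 * real K) = (\<alpha> / K) / 4" by simp
    ultimately show False using p[OF that] e(4) by linarith
  qed
  have "snd (p j) \<ge> (real j + 1) * \<eta>" if "j \<le> K" for j
    using that
  proof (induction j)
    case 0
    then show ?case using gap[of 0] p[of 0] by simp
  next
    case (Suc j)
    then show ?case using gap[of "Suc j"] step[of j] by (simp add: algebra_simps)
  qed
  from this[of K] show False using K \<eta>(1) le_q[of K] by (simp add: algebra_simps)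
qed

lemma mono_continuous_preimage:
  fixes H :: "real \<Rightarrow> real"
  assumes "continuous_on UNIV H" "mono H" "H 0 = 0" "0 \<le> u" "t \<in> {0..H u}"
  obtains v where "v \<in> {0..u}" "H v = t"
  using IVT'[of H 0 t u] assms continuous_on_subset by (metis atLeastAtMost_iff top_greatest)

text \<open>Conjugation by \<open>G = h ^^ k\<close> divides the error of \<open>H\<close> by
  \<open>2 ^ k\<close>, as \<open>F (G s) = 2 ^ k * F s\<close> holds exactly. The drop from
  \<open>a\<close> to \<open>b\<close> thus has a copy scaled by any \<open>l\<close> in
  \<open>[1, 2]\<close> with arbitrarily small error, which \<open>no_scalable_drop\<close>
  forbids.\<close>

lemma no_drop_self_similar:
  fixes F h :: "real \<Rightarrow> real"
  assumes cont: "continuous_on UNIV F" and lim: "filterlim F at_top at_top"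
    and h: "continuous_on UNIV h" "mono h" "h 0 = 0" "filterlim h at_top at_top"
    and exact: "\<And>s. s \<ge> 0 \<Longrightarrow> F (h s) = 2 * F s"
    and quasi: "\<And>l. 1 \<le> l \<Longrightarrow> l \<le> 2 \<Longrightarrow> \<exists>H C. continuous_on UNIV H \<and> mono H \<and> H 0 = 0 \<and>
        (\<forall>s\<ge>0. \<bar>F (H s) - l * F s\<bar> \<le> C)"
    and ab: "0 \<le> a" "a \<le> b" "\<And>t. t \<in> {0..b} \<Longrightarrow> F t \<le> F a" "F a > 0" "F b < F a"
  shows False
proof (rule no_scalable_drop[OF cont lim _ ab(4,5)])
  fix l e :: real
  assume l: "1 \<le> l" "l \<le> 2" and e: "e > 0"
  obtain H C where H: "continuous_on UNIV H" "mono H" "H 0 = 0" and C: "\<And>s. s \<ge> 0 \<Longrightarrow> \<bar>F (H s) - l * F s\<bar> \<le> C"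
    using quasi[OF l] by blast
  obtain k where k: "C / e < 2 ^ k" using real_arch_pow[of 2] by (metis one_less_numeral_iff semiring_norm(76))
  have nn: "0 \<le> (h ^^ n) s" if "0 \<le> s" for n s
  proof (induction n)
    case (Suc n)
    then show ?case using monoD[OF h(2) Suc] h(3) by simp
  qed (use that in simp)
  define G where "G = h ^^ k"
  have G: "continuous_on UNIV G \<and> mono G \<and> G 0 = 0"
    unfolding G_def
    by (induction k) (use h in \<open>auto intro!: continuous_on_compose2[of UNIV h] simp: mono_def o_def\<close>)
  have FG: "F (G s) = 2 ^ k * F s" if "0 \<le> s" for s
    unfolding G_def using that by (induction k) (auto simp: exact nn)
  have Glim: "filterlim G at_top at_top" unfolding G_def
  proof (induction k)
    case (Suc k)
    then show ?case using filterlim_compose[OF h(4)] by (auto simp: o_def)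
  qed (auto simp: filterlim_ident id_def)
  have G0: "0 \<le> G s" if "0 \<le> s" for s using nn[OF that] by (simp add: G_def)
  have H0: "0 \<le> H s" if "0 \<le> s" for s using monoD[OF H(2) that] H(3) by simp
  have "eventually (\<lambda>s. G s \<ge> H (G b) \<and> s \<ge> 0) at_top"
    using Glim by (auto intro!: eventually_conj simp: filterlim_at_top eventually_ge_at_top)
  then obtain q where q: "G q \<ge> H (G b)" "q \<ge> 0"
    unfolding eventually_at_top_linorder by blast
  have b: "0 \<le> b" using ab by simp
  txt \<open>\<open>v'\<close> is a value at \<open>v\<close> of the multivalued map \<open>inv G \<circ> H \<circ> G\<close>; its error is only \<open>C / 2\<^sup>k\<close>.\<close>
  have pull: "\<exists>v'\<in>{0..q}. G v' = H (G v)" if "v \<in> {0..b}" for v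
  proof -
    have "H (G v) \<le> H (G b)" using that G H(2) by (auto simp: mono_def)
    then have "H (G v) \<in> {0..G q}" using q G0 H0 that by auto
    then show ?thesis using mono_continuous_preimage[of G q] G q by metis
  qed
  have est: "\<bar>F v' - l * F v\<bar> \<le> e" if "v' \<ge> 0" "v \<ge> 0" "G v' = H (G v)" for v' v
  proof -
    have "\<bar>F (H (G v)) - l * F (G v)\<bar> \<le> C" using C G0 that by blast
    then have "\<bar>2 ^ k * F v' - l * (2 ^ k * F v)\<bar> \<le> C" using FG that by metis
    moreover have "2 ^ k * F v' - l * (2 ^ k * F v) = 2 ^ k * (F v' - l * F v)" by (simp add: algebra_simps)
    ultimately have "2 ^ k * \<bar>F v' - l * F v\<bar> \<le> C" by (simp add: abs_mult)
    also have "C \<le> 2 ^ k * e" using k e by (simp add: field_simps)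
    finally show ?thesis by simp
  qed
  obtain a' where a': "a' \<in> {0..q}" "G a' = H (G a)" using pull[of a] ab by auto
  obtain b0 where b0: "b0 \<in> {0..q}" "G b0 = H (G b)" using pull[of b] ab by auto
  \<comment> \<open>\<open>G\<close> need not be injective, so \<open>b0\<close> may lie left of
    \<open>a'\<close>. In that case \<open>G\<close> takes the same value at both, and
    \<open>a'\<close> can replace \<open>b0\<close>.\<close>
  define b' where "b' = max a' b0"
  have Gb': "G b' = H (G b)"
  proof -
    have "H (G a) \<le> H (G b)" using ab G H(2) by (auto simp: mono_def)
    moreover have "G b0 \<le> G a'" if "b0 \<le> a'" using that G by (auto simp: mono_def)
    ultimately show ?thesis using a' b0 unfolding b'_def max_def by auto
  qed
  have b'0: "0 \<le> b'" "a' \<le> b'" using a' by (auto simp: b'_def)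
  \<comment> \<open>\<open>H\<close> maps \<open>{0..G b}\<close> onto \<open>{0..H (G b)}\<close>
    and \<open>G\<close> maps \<open>{0..b}\<close> onto \<open>{0..G b}\<close>, so every
    \<open>t\<close> up to \<open>b'\<close> corresponds to some \<open>v\<close> in
    \<open>{0..b}\<close>, where \<open>F a\<close> is the maximum.\<close>
  have "F t \<le> l * F a + e" if t: "t \<in> {0..b'}" for t
  proof -
    have "G t \<in> {0..H (G b)}" using t Gb' G0 G by (auto simp: mono_def simp flip: Gb')
    then obtain u where u: "u \<in> {0..G b}" "H u = G t"
      using mono_continuous_preimage[OF H G0[OF b]] by blast
    then obtain v where v: "v \<in> {0..b}" "G v = u"
      using mono_continuous_preimage[of G b] G b by metis
    have "\<bar>F t - l * F v\<bar> \<le> e" using est[of t v] u v t by auto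
    moreover have "l * F v \<le> l * F a" using ab(3)[OF v(1)] l by simp
    ultimately show ?thesis by linarith
  qed
  moreover have "\<bar>F a' - l * F a\<bar> \<le> e" "\<bar>F b' - l * F b\<bar> \<le> e"
    using est a' ab(1) b b'0 Gb' by auto
  ultimately show "\<exists>a' b'. 0 \<le> a' \<and> a' \<le> b' \<and> F a' \<ge> l * F a - e \<and> F b' \<le> l * F b + e \<and> (\<forall>t\<in>{0..b'}. F t \<le> l * F a + e)"
    using a' b'0 by (intro exI[of _ a'] exI[of _ b']) auto
qed

lemma bounded_if_convergent_at_top:
  fixes g :: "real \<Rightarrow> real"
  assumes cont: "continuous_on {0..} g" and lim: "(g \<longlongrightarrow> c) at_top"
  obtains C where "\<And>s. s \<ge> 0 \<Longrightarrow> \<bar>g s\<bar> \<le> C"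
proof -
  have "eventually (\<lambda>s. dist (g s) c < 1) at_top" using lim by (rule tendstoD) simp
  then obtain N where N: "\<And>s. s \<ge> N \<Longrightarrow> dist (g s) c < 1" unfolding eventually_at_top_linorder by blast
  have "bounded (g ` {0..N})"
    using cont by (intro compact_imp_bounded compact_continuous_image) (auto intro: continuous_on_subset)
  then obtain B where B: "\<And>s. s \<in> {0..N} \<Longrightarrow> \<bar>g s\<bar> \<le> B"
    unfolding bounded_iff by (metis image_eqI real_norm_def)
  have "\<bar>g s\<bar> \<le> max B (\<bar>c\<bar> + 1)" if "s \<ge> 0" for s
    using B[of s] N[of s] that by (cases "s \<le> N") (auto simp: dist_real_def)
  then show ?thesis using that by blast
qed

text \<open>\<open>E\<close> adds up the defects \<open>F (h s) - 2 * F s\<close> along the orbit of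
  \<open>s\<close> under \<open>h\<close>, with weights \<open>(1 / 2) ^ Suc k\<close>. These sum to
  1, so \<open>E\<close> keeps the bound and the limit of the defect: exact scaling costs only a
  convergent perturbation.\<close>

lemma self_similar_perturbation:
  fixes F h :: "real \<Rightarrow> real"
  assumes cont: "continuous_on UNIV F"
    and h: "continuous_on UNIV h" "mono h" "h 0 = 0" "filterlim h at_top at_top"
    and lim: "((\<lambda>s. F (h s) - 2 * F s) \<longlongrightarrow> c) at_top"
  obtains E C where "continuous_on UNIV E" "\<And>s. \<bar>E s\<bar> \<le> C" "(E \<longlongrightarrow> c) at_top"
    "\<And>s. s \<ge> 0 \<Longrightarrow> F (h s) + E (h s) = 2 * (F s + E s)"
proof -
  define e where "e s = F (h s) - 2 * F s" for s
  have conte: "continuous_on UNIV e"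
    unfolding e_def by (intro continuous_intros continuous_on_compose2[OF cont] h cont) auto
  obtain C where C: "\<And>s. s \<ge> 0 \<Longrightarrow> \<bar>e s\<bar> \<le> C"
    using bounded_if_convergent_at_top[of e c] conte lim continuous_on_subset
    unfolding e_def by blast
  have nn: "0 \<le> (h ^^ n) s" if "0 \<le> s" for n s
  proof (induction n)
    case (Suc n)
    then show ?case using monoD[OF h(2) Suc] h(3) by simp
  qed (use that in simp)
  txt \<open>Telescoping \<open>F (h\<^sup>k s) / 2\<^sup>k\<close>; the \<open>max\<close> makes the terms continuous on the whole line.\<close>
  define a where "a k s = e ((h ^^ k) (max 0 s)) * (1 / 2) ^ Suc k" for k s
  define E where "E s = (\<Sum>k. a k s)" for s
  have bound: "\<bar>a k s\<bar> \<le> C * (1 / 2) ^ Suc k" for k s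
    using C[OF nn[of "max 0 s" k]] unfolding a_def by (simp add: abs_mult)
  have summ: "summable (\<lambda>k. C * (1 / 2 :: real) ^ Suc k)"
    by (intro summable_mult summable_Suc_iff[THEN iffD2] summable_geometric) simp
  have suma: "summable (\<lambda>k. a k s)" for s
    using bound by (intro summable_comparison_test'[OF summ, of 0]) auto
  have geo: "(\<lambda>k. x * (1 / 2) ^ Suc k) sums x" for x :: real
    using sums_mult[OF power_half_series, of x] by simp
  have conta: "continuous_on UNIV (a k)" for k
  proof -
    have "continuous_on UNIV (h ^^ k)"
      by (induction k) (auto simp: o_def intro!: continuous_on_compose2[OF h(1)])
    then have "continuous_on UNIV (\<lambda>s. (h ^^ k) (max 0 s))"
      by (rule continuous_on_compose2) (auto intro!: continuous_intros)
    then show ?thesis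
      unfolding a_def by (intro continuous_intros continuous_on_compose2[OF conte]) auto
  qed
  have "uniform_limit UNIV (\<lambda>n s. \<Sum>k<n. a k s) (\<lambda>s. suminf (\<lambda>k. a k s)) sequentially"
    using bound by (intro Weierstrass_m_test[OF _ summ]) auto
  then have contE: "continuous_on UNIV E"
    unfolding E_def
    by (rule uniform_limit_theorem[rotated]) (auto intro!: always_eventually continuous_on_sum conta)
  have boundE: "\<bar>E s\<bar> \<le> C" for s
  proof -
    have "norm (suminf (\<lambda>k. a k s)) \<le> (\<Sum>k. C * (1 / 2) ^ Suc k)"
      using bound by (intro norm_suminf_le summ) auto
    then show ?thesis using geo[of C, THEN sums_unique] unfolding E_def by simp
  qed
  have hlim: "filterlim (h ^^ k) at_top at_top" for k
  proof (induction k)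
    case (Suc k)
    then show ?case using filterlim_compose[OF h(4)] by (auto simp: o_def)
  qed (auto simp: filterlim_ident id_def)
  have max_lim: "filterlim (\<lambda>s::real. max 0 s) at_top at_top"
    by (rule filterlim_at_top_mono[OF filterlim_ident]) auto
  \<comment> \<open>Each term tends to \<open>c\<close> times its weight, and the geometric bound
    lets Tannery's theorem exchange limit and sum.\<close>
  have "(a k \<longlongrightarrow> c * (1 / 2) ^ Suc k) at_top" for k
  proof -
    have "((\<lambda>s. e ((h ^^ k) (max 0 s))) \<longlongrightarrow> c) at_top"
      using filterlim_compose[OF lim[folded e_def] filterlim_compose[OF hlim max_lim]] .
    then show ?thesis unfolding a_def by (intro tendsto_intros)
  qed
  moreover have "eventually (\<lambda>(k, s). norm (a k s) \<le> C * (1 / 2) ^ Suc k) (at_top \<times>\<^sub>F at_top)"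
    using bound by (intro always_eventually) auto
  ultimately have "(E \<longlongrightarrow> (\<Sum>k. c * (1 / 2) ^ Suc k)) at_top"
    unfolding E_def
    by (rule tannerys_theorem[OF _ _ summ trivial_limit_at_top_linorder, THEN conjunct2, THEN conjunct2])
  then have limE: "(E \<longlongrightarrow> c) at_top" using geo[of c, THEN sums_unique] by simp
  have "F (h s) + E (h s) = 2 * (F s + E s)" if "s \<ge> 0" for s
  proof -
    have hs: "h s \<ge> 0" using nn[OF that, of 1] by simp
    \<comment> \<open>The index shift gives \<open>E (h s) = 2 * E s - e s\<close>, which cancels
      the defect of \<open>F\<close>.\<close>
    have "a k (h s) = 2 * a (Suc k) s" for k
      using that hs unfolding a_def by (simp add: funpow_swap1 max_def)
    then have "E (h s) = 2 * (\<Sum>k. a (Suc k) s)"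
      unfolding E_def using suminf_mult[of "\<lambda>k. a (Suc k) s" 2] suma[of s]
      by (simp add: summable_Suc_iff[of "\<lambda>k. a k s"])
    also have "(\<Sum>k. a (Suc k) s) = E s - a 0 s"
      unfolding E_def using suminf_split_head[OF suma] .
    also have "a 0 s = e s / 2" using that by (simp add: a_def)
    finally show ?thesis by (simp add: e_def field_simps)
  qed
  then show ?thesis using that contE boundE limE by blast
qed

text \<open>\<open>M\<close> is \<open>F + E\<close>, which scales exactly under the map for
  \<open>l = 2\<close>. For the other factors a bounded error suffices, and that survives passing
  from \<open>F\<close> to \<open>M\<close>. A decrease of \<open>M\<close> where it is positive
  would then be a drop excluded by \<open>no_drop_self_similar\<close>.\<close>

lemma eventually_mono_perturbation:
  fixes F :: "real \<Rightarrow> real"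
  assumes cont: "continuous_on UNIV F" and lim: "filterlim F at_top at_top"
    and scale: "\<And>l. 1 \<le> l \<Longrightarrow> l \<le> 2 \<Longrightarrow> \<exists>H c. continuous_on UNIV H \<and> mono H \<and> H 0 = 0 \<and>
      filterlim H at_top at_top \<and> ((\<lambda>s. F (H s) - l * F s) \<longlongrightarrow> c) at_top"
  obtains M s0 c where "continuous_on UNIV M" "mono_on {s0..} M" "filterlim M at_top at_top"
    "((\<lambda>s. F s - M s) \<longlongrightarrow> c) at_top"
proof -
  obtain h c where h: "continuous_on UNIV h" "mono h" "h 0 = 0" "filterlim h at_top at_top"
    and hc: "((\<lambda>s. F (h s) - 2 * F s) \<longlongrightarrow> c) at_top"
    using scale[of 2] by auto
  obtain E C where E: "continuous_on UNIV E" "\<And>s. \<bar>E s\<bar> \<le> C" "(E \<longlongrightarrow> c) at_top"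
    "\<And>s. s \<ge> 0 \<Longrightarrow> F (h s) + E (h s) = 2 * (F s + E s)"
    using self_similar_perturbation[OF cont h hc] by blast
  define M where "M s = F s + E s" for s
  have contM: "continuous_on UNIV M" unfolding M_def by (intro continuous_intros cont E)
  have "filterlim (\<lambda>s. E s + F s) at_top at_top"
    by (rule filterlim_tendsto_add_at_top[OF E(3) lim])
  then have limM: "filterlim M at_top at_top" unfolding M_def by (simp add: add.commute)
  have quasi: "\<exists>H C'. continuous_on UNIV H \<and> mono H \<and> H 0 = 0 \<and> (\<forall>s\<ge>0. \<bar>M (H s) - l * M s\<bar> \<le> C')"
    if l: "1 \<le> l" "l \<le> 2" for l
  proof -
    obtain H c' where H: "continuous_on UNIV H" "mono H" "H 0 = 0"
      and c': "((\<lambda>s. F (H s) - l * F s) \<longlongrightarrow> c') at_top"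
      using scale[OF l] by blast
    have "continuous_on {0..} (\<lambda>s. F (H s) - l * F s)"
      by (rule continuous_on_subset[of UNIV])
        (intro continuous_intros continuous_on_compose2[OF cont] H cont, auto)
    then obtain C' where C': "\<And>s. s \<ge> 0 \<Longrightarrow> \<bar>F (H s) - l * F s\<bar> \<le> C'"
      using bounded_if_convergent_at_top c' by blast
    have "\<bar>M (H s) - l * M s\<bar> \<le> C' + 3 * C" if "s \<ge> 0" for s
    proof -
      have "\<bar>l * E s\<bar> \<le> 2 * C" using E(2)[of s] l by (auto simp: abs_mult intro!: mult_mono)
      moreover have "M (H s) - l * M s = (F (H s) - l * F s) + E (H s) - l * E s"
        by (simp add: M_def algebra_simps)
      ultimately show ?thesis using C'[OF that] E(2)[of "H s"] by linarith
    qed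
    then show ?thesis using H by blast
  qed
  have "eventually (\<lambda>s. M s > 0 \<and> s \<ge> 0) at_top"
    using limM by (auto intro!: eventually_conj eventually_ge_at_top simp: filterlim_at_top_dense)
  then obtain s0 where s0: "\<And>s. s \<ge> s0 \<Longrightarrow> M s > 0 \<and> s \<ge> 0" unfolding eventually_at_top_linorder by blast
  have "mono_on {s0..} M"
  proof (rule mono_onI, rule ccontr)
    fix x y assume xy: "x \<in> {s0..}" "y \<in> {s0..}" "x \<le> y" "\<not> M x \<le> M y"
    have x0: "0 \<le> x" "0 < M x" using s0 xy by auto
    \<comment> \<open>The maximum is taken over all of \<open>{0..y}\<close>, not just from
      \<open>x\<close> on, because a drop has to start from a running maximum.\<close>
    obtain a where a: "a \<in> {0..y}" "\<And>t. t \<in> {0..y} \<Longrightarrow> M t \<le> M a"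
      using continuous_attains_sup[of "{0..y}" M] contM x0 xy
      by (metis atLeastAtMost_iff compact_Icc continuous_on_subset empty_iff top_greatest)
    have "M x \<le> M a" using a(2)[of x] x0 xy by auto
    then have "M a > 0" "M y < M a" using x0 xy by auto
    moreover have "M (h s) = 2 * M s" if "s \<ge> 0" for s using E(4)[OF that] by (simp add: M_def)
    ultimately show False
      using no_drop_self_similar[OF contM limM h _ quasi, of a y] a by auto
  qed
  moreover have "((\<lambda>s. F s - M s) \<longlongrightarrow> - c) at_top"
    unfolding M_def using tendsto_minus[OF E(3)] by simp
  ultimately show ?thesis using that contM limM by blast
qed

section \<open>Coordinates for flows with the Reeb foliation\<close>

lemma reeb_space_iff: "p \<in> reeb_space \<longleftrightarrow> 0 \<le> fst p \<and> 0 \<le> snd p \<and> (fst p > 0 \<or> snd p > 0)"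
  by (cases p) (auto simp: reeb_space_def)

lemma fst_reeb_flow [simp]: "fst (reeb_flow t p) = exp t * fst p"
  and snd_reeb_flow [simp]: "snd (reeb_flow t p) = exp (- t) * snd p"
  by (simp_all add: reeb_flow_def)

lemma reeb_flow_add: "reeb_flow (s + t) p = reeb_flow s (reeb_flow t p)"
  by (simp add: prod_eq_iff mult_exp_exp mult.assoc[symmetric])

lemma reeb_flow_0 [simp]: "reeb_flow 0 p = p"
  by (simp add: prod_eq_iff)

lemma reeb_flow_in_space: "p \<in> reeb_space \<Longrightarrow> reeb_flow t p \<in> reeb_space"
  by (auto simp: reeb_space_iff)

lemma reeb_flow_inject:
  assumes "p \<in> reeb_space"
  shows "reeb_flow s p = reeb_flow t p \<longleftrightarrow> s = t"
  using assms by (auto simp: reeb_space_iff prod_eq_iff)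

lemma reeb_flow_to_vertical:
  assumes "snd p > 0"
  shows "reeb_flow (- ln (snd p)) (fst p * snd p, 1) = p"
  using assms by (simp add: prod_eq_iff exp_minus)

lemma reeb_flow_to_horizontal:
  assumes "fst p > 0"
  shows "reeb_flow (ln (fst p)) (1, fst p * snd p) = p"
  using assms by (simp add: prod_eq_iff exp_minus)

lemma reeb_foliation_flow_reeb_flow: "reeb_foliation_flow reeb_flow"
proof -
  have "continuous_on (UNIV \<times> reeb_space) (\<lambda>(t, p). reeb_flow t p)"
    unfolding reeb_flow_def case_prod_beta by (intro continuous_intros)
  then show ?thesis
    unfolding reeb_foliation_flow_def continuous_flow_on_def
    by (auto simp: reeb_flow_in_space reeb_flow_add)
qed

section \<open>Time along the leaves and the transit between two sections\<close>

locale reeb_like_flow =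
  fixes \<phi> :: "real \<Rightarrow> real \<times> real \<Rightarrow> real \<times> real"
  assumes reeb_foliation_flow: "reeb_foliation_flow \<phi>"
begin

lemma flow_continuous: "continuous_on (UNIV \<times> reeb_space) (\<lambda>(t, p). \<phi> t p)"
  and flow_in_space: "p \<in> reeb_space \<Longrightarrow> \<phi> t p \<in> reeb_space"
  and flow_0: "p \<in> reeb_space \<Longrightarrow> \<phi> 0 p = p"
  and flow_add: "p \<in> reeb_space \<Longrightarrow> \<phi> (s + t) p = \<phi> s (\<phi> t p)"
  and flow_forward: "p \<in> reeb_space \<Longrightarrow> t > 0 \<Longrightarrow> \<exists>s>0. \<phi> t p = reeb_flow s p"
  using reeb_foliation_flow unfolding reeb_foliation_flow_def continuous_flow_on_def by blast+

lemma continuous_on_flow: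
  assumes "continuous_on A f" "continuous_on A g" "\<And>x. x \<in> A \<Longrightarrow> g x \<in> reeb_space"
  shows "continuous_on A (\<lambda>x. \<phi> (f x) (g x))"
  using continuous_on_compose2[OF flow_continuous continuous_on_Pair[OF assms(1,2)]] assms(3) by auto

text \<open>The hypothesis only equates the two families of orbits. The orbit of \<open>p\<close> is
  some standard orbit containing \<open>p\<close>, and a standard orbit is determined by any of its
  points.\<close>

lemma flow_orbit_eq:
  assumes p: "p \<in> reeb_space"
  shows "flow_orbit \<phi> p = flow_orbit reeb_flow p"
proof -
  have "flow_orbit \<phi> p \<in> flow_orbits reeb_space reeb_flow"
    using reeb_foliation_flow p unfolding reeb_foliation_flow_def flow_orbits_def by blast
  then obtain q where q: "flow_orbit \<phi> p = flow_orbit reeb_flow q" by (auto simp: flow_orbits_def)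
  have "p \<in> flow_orbit \<phi> p" unfolding flow_orbit_def using flow_0[OF p] by (metis rangeI)
  then obtain s where s: "p = reeb_flow s q" using q unfolding flow_orbit_def by auto
  have "flow_orbit reeb_flow p = flow_orbit reeb_flow q"
    unfolding flow_orbit_def s
  proof (intro set_eqI iffI)
    fix x assume "x \<in> range (\<lambda>t. reeb_flow t q)"
    then obtain t where "x = reeb_flow t q" by auto
    then have "x = reeb_flow (t - s) (reeb_flow s q)" by (simp flip: reeb_flow_add)
    then show "x \<in> range (\<lambda>t. reeb_flow t (reeb_flow s q))" by blast
  qed (auto simp flip: reeb_flow_add)
  then show ?thesis using q by simp
qed

lemma flow_inject:
  assumes "p \<in> reeb_space"
  shows "\<phi> s p = \<phi> t p \<longleftrightarrow> s = t"
proof -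
  have "\<phi> t p \<noteq> \<phi> s p" if st: "s < t" for s t
  proof -
    obtain r where "r > 0" "\<phi> (t - s) (\<phi> s p) = reeb_flow r (\<phi> s p)"
      using flow_forward[OF flow_in_space[OF assms, of s], of "t - s"] st by auto
    then show ?thesis
      using flow_add[OF assms, of "t - s" s] reeb_flow_inject[OF flow_in_space[OF assms, of s], of r 0] by simp
  qed
  then show ?thesis by (metis linorder_neqE_linordered_idom)
qed

text \<open>The \<open>\<phi>\<close>-time in which the orbit of \<open>p\<close> covers the standard time \<open>s\<close>.\<close>

definition travel :: "real \<Rightarrow> real \<times> real \<Rightarrow> real" where
  "travel s p = (THE t. \<phi> t p = reeb_flow s p)"

lemma flow_travel:
  assumes "p \<in> reeb_space"
  shows "\<phi> (travel s p) p = reeb_flow s p"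
proof -
  have "reeb_flow s p \<in> flow_orbit \<phi> p"
    using flow_orbit_eq[OF assms] unfolding flow_orbit_def by auto
  then obtain t where t: "\<phi> t p = reeb_flow s p" unfolding flow_orbit_def by auto
  have "travel s p = t"
    unfolding travel_def using t by (rule the_equality) (metis t flow_inject[OF assms])
  then show ?thesis using t by simp
qed

lemma travel_unique: "p \<in> reeb_space \<Longrightarrow> \<phi> t p = reeb_flow s p \<Longrightarrow> travel s p = t"
  using flow_travel flow_inject by metis

lemma flow_fst_mult_snd:
  assumes "p \<in> reeb_space"
  shows "fst (\<phi> t p) * snd (\<phi> t p) = fst p * snd p"
proof -
  have "\<phi> t p \<in> flow_orbit reeb_flow p"
    using flow_orbit_eq[OF assms] unfolding flow_orbit_def by auto
  then show ?thesis by (auto simp: flow_orbit_def exp_minus)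
qed

lemma flow_less:
  assumes "p \<in> reeb_space" "s < t"
  shows "fst (\<phi> s p) \<le> fst (\<phi> t p)" "snd (\<phi> t p) \<le> snd (\<phi> s p)"
    "fst (\<phi> s p) < fst (\<phi> t p) \<or> snd (\<phi> t p) < snd (\<phi> s p)"
proof -
  let ?q = "\<phi> s p"
  have q: "?q \<in> reeb_space" by (rule flow_in_space[OF assms(1)])
  obtain r where "r > 0" "\<phi> (t - s) ?q = reeb_flow r ?q"
    using flow_forward[OF q, of "t - s"] assms by auto
  then have r: "r > 0" "\<phi> t p = reeb_flow r ?q" using flow_add[OF assms(1), of "t - s" s] by auto
  then show "fst (\<phi> s p) \<le> fst (\<phi> t p)" "snd (\<phi> t p) \<le> snd (\<phi> s p)"
    "fst (\<phi> s p) < fst (\<phi> t p) \<or> snd (\<phi> t p) < snd (\<phi> s p)"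
    using q by (auto simp: reeb_space_iff mult_le_cancel_right1 mult_le_cancel_right2)
qed

text \<open>Along an orbit \<open>fst\<close> never decreases, \<open>snd\<close> never increases,
  and at least one changes strictly; the disjunction also covers the axes, where one coordinate
  stays 0. Comparisons with \<open>travel\<close> thus become strict inequalities between continuous
  functions.\<close>

lemma less_travel_iff:
  assumes "p \<in> reeb_space"
  shows "t < travel s p \<longleftrightarrow> fst (\<phi> t p) < exp s * fst p \<or> exp (- s) * snd p < snd (\<phi> t p)"
proof -
  have e: "exp s * fst p = fst (\<phi> (travel s p) p)" "exp (- s) * snd p = snd (\<phi> (travel s p) p)"
    using flow_travel[OF assms] by simp_all
  show ?thesis
    unfolding e using flow_less[OF assms] by (metis linorder_neqE_linordered_idom not_less)
qed

lemma travel_less_iff: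
  assumes "p \<in> reeb_space"
  shows "travel s p < t \<longleftrightarrow> exp s * fst p < fst (\<phi> t p) \<or> snd (\<phi> t p) < exp (- s) * snd p"
proof -
  have e: "exp s * fst p = fst (\<phi> (travel s p) p)" "exp (- s) * snd p = snd (\<phi> (travel s p) p)"
    using flow_travel[OF assms] by simp_all
  show ?thesis
    unfolding e using flow_less[OF assms] by (metis linorder_neqE_linordered_idom not_less)
qed

text \<open>For each fixed \<open>a\<close>, both \<open>a < travel (f x) (g x)\<close> and its
  reverse are open conditions in \<open>x\<close> by the two preceding equivalences.\<close>

lemma continuous_on_travel:
  fixes f :: "'b::topological_space \<Rightarrow> real"
  assumes f: "continuous_on A f" and g: "continuous_on A g" "\<And>x. x \<in> A \<Longrightarrow> g x \<in> reeb_space"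
  shows "continuous_on A (\<lambda>x. travel (f x) (g x))"
  unfolding continuous_on_def
proof (intro ballI order_tendstoI)
  fix x a assume x: "x \<in> A"
  have A: "eventually (\<lambda>y. y \<in> A) (at x within A)" unfolding eventually_at_filter by simp
  have "continuous_on A (\<lambda>x. \<phi> a (g x))" by (rule continuous_on_flow[OF continuous_on_const g])
  then have lim: "((\<lambda>x. \<phi> a (g x)) \<longlongrightarrow> \<phi> a (g x)) (at x within A)"
    "(f \<longlongrightarrow> f x) (at x within A)" "(g \<longlongrightarrow> g x) (at x within A)"
    using f g x by (auto simp: continuous_on_def)
  have fst: "((\<lambda>x. fst (\<phi> a (g x)) - exp (f x) * fst (g x)) \<longlongrightarrow> fst (\<phi> a (g x)) - exp (f x) * fst (g x)) (at x within A)"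
    and snd: "((\<lambda>x. snd (\<phi> a (g x)) - exp (- f x) * snd (g x)) \<longlongrightarrow> snd (\<phi> a (g x)) - exp (- f x) * snd (g x)) (at x within A)"
    by (intro tendsto_intros lim)+
  {
    assume "a < travel (f x) (g x)"
    then consider "fst (\<phi> a (g x)) - exp (f x) * fst (g x) < 0" | "snd (\<phi> a (g x)) - exp (- f x) * snd (g x) > 0"
      using less_travel_iff g(2)[OF x] by auto
    then show "eventually (\<lambda>x. a < travel (f x) (g x)) (at x within A)"
    proof cases
      case 1
      show ?thesis using A order_tendstoD(2)[OF fst 1]
        by eventually_elim (use g(2) less_travel_iff in auto)
    next
      case 2
      show ?thesis using A order_tendstoD(1)[OF snd 2]
        by eventually_elim (use g(2) less_travel_iff in auto)
    qed
  }
  {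
    assume "travel (f x) (g x) < a"
    then consider "fst (\<phi> a (g x)) - exp (f x) * fst (g x) > 0" | "snd (\<phi> a (g x)) - exp (- f x) * snd (g x) < 0"
      using travel_less_iff g(2)[OF x] by auto
    then show "eventually (\<lambda>x. travel (f x) (g x) < a) (at x within A)"
    proof cases
      case 1
      show ?thesis using A order_tendstoD(1)[OF fst 1]
        by eventually_elim (use g(2) travel_less_iff in auto)
    next
      case 2
      show ?thesis using A order_tendstoD(2)[OF snd 2]
        by eventually_elim (use g(2) travel_less_iff in auto)
    qed
  }
qed

text \<open>
  The \<open>\<phi>\<close>-times to \<open>p\<close> from the sections \<open>y = 1\<close> and \<open>x = 1\<close>. They are meaningful only for
  \<open>snd p > 0\<close> and \<open>fst p > 0\<close> respectively, and \<open>fst p * snd p\<close> labels the leaf.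
\<close>

definition vert_time :: "real \<times> real \<Rightarrow> real" where
  "vert_time p = travel (- ln (snd p)) (fst p * snd p, 1)"

definition horiz_time :: "real \<times> real \<Rightarrow> real" where
  "horiz_time p = travel (ln (fst p)) (1, fst p * snd p)"

lemma section_in_space [simp]: "0 \<le> x \<Longrightarrow> (x, 1) \<in> reeb_space" "0 \<le> x \<Longrightarrow> (1, x) \<in> reeb_space"
  by (auto simp: reeb_space_iff)

lemma flow_vert_time:
  assumes "p \<in> reeb_space" "snd p > 0"
  shows "\<phi> (vert_time p) (fst p * snd p, 1) = p"
  using assms flow_travel[of "(fst p * snd p, 1)"] reeb_flow_to_vertical[of p]
  by (auto simp: vert_time_def reeb_space_iff)

lemma flow_horiz_time:
  assumes "p \<in> reeb_space" "fst p > 0"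
  shows "\<phi> (horiz_time p) (1, fst p * snd p) = p"
  using assms flow_travel[of "(1, fst p * snd p)"] reeb_flow_to_horizontal[of p]
  by (auto simp: horiz_time_def reeb_space_iff)

lemma flow_eq_reeb_flow: "p \<in> reeb_space \<Longrightarrow> \<exists>s. \<phi> t p = reeb_flow s p"
  using flow_orbit_eq[of p] unfolding flow_orbit_def by blast

lemma snd_flow_pos: "p \<in> reeb_space \<Longrightarrow> snd p > 0 \<Longrightarrow> snd (\<phi> t p) > 0"
  using flow_eq_reeb_flow[of p t] by auto

lemma fst_flow_pos: "p \<in> reeb_space \<Longrightarrow> fst p > 0 \<Longrightarrow> fst (\<phi> t p) > 0"
  using flow_eq_reeb_flow[of p t] by auto

lemma vert_time_flow:
  assumes "p \<in> reeb_space" "snd p > 0"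
  shows "vert_time (\<phi> t p) = t + vert_time p"
proof -
  let ?v = "(fst p * snd p, 1 :: real)"
  have v: "?v \<in> reeb_space" using assms by (simp add: reeb_space_iff)
  have "\<phi> (vert_time (\<phi> t p)) ?v = \<phi> t p"
    using flow_vert_time[OF flow_in_space[OF assms(1), of t] snd_flow_pos[OF assms]] flow_fst_mult_snd[OF assms(1)] by simp
  also have "\<dots> = \<phi> (t + vert_time p) ?v" using flow_vert_time[OF assms] flow_add[OF v] by simp
  finally show ?thesis using flow_inject[OF v] by simp
qed

lemma horiz_time_flow:
  assumes "p \<in> reeb_space" "fst p > 0"
  shows "horiz_time (\<phi> t p) = t + horiz_time p"
proof -
  let ?v = "(1 :: real, fst p * snd p)"
  have v: "?v \<in> reeb_space" using assms by (simp add: reeb_space_iff)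
  have "\<phi> (horiz_time (\<phi> t p)) ?v = \<phi> t p"
    using flow_horiz_time[OF flow_in_space[OF assms(1), of t] fst_flow_pos[OF assms]] flow_fst_mult_snd[OF assms(1)] by simp
  also have "\<dots> = \<phi> (t + horiz_time p) ?v" using flow_horiz_time[OF assms] flow_add[OF v] by simp
  finally show ?thesis using flow_inject[OF v] by simp
qed

lemma vert_time_section [simp]: "0 \<le> x \<Longrightarrow> vert_time (x, 1) = 0"
  and horiz_time_section [simp]: "0 \<le> x \<Longrightarrow> horiz_time (1, x) = 0"
  using flow_vert_time[of "(x, 1)"] flow_inject[of "(x, 1)" _ 0] flow_0[of "(x, 1)"]
    flow_horiz_time[of "(1, x)"] flow_inject[of "(1, x)" _ 0] flow_0[of "(1, x)"] by auto

lemma continuous_on_vert_time: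
  assumes g: "continuous_on A g" "\<And>x. x \<in> A \<Longrightarrow> g x \<in> reeb_space \<and> snd (g x) > 0"
  shows "continuous_on A (\<lambda>x. vert_time (g x))"
  unfolding vert_time_def using g(2)
  by (intro continuous_on_travel continuous_intros g) (force simp: reeb_space_iff)+

lemma continuous_on_horiz_time:
  assumes g: "continuous_on A g" "\<And>x. x \<in> A \<Longrightarrow> g x \<in> reeb_space \<and> fst (g x) > 0"
  shows "continuous_on A (\<lambda>x. horiz_time (g x))"
  unfolding horiz_time_def using g(2)
  by (intro continuous_on_travel continuous_intros g) (force simp: reeb_space_iff)+

text \<open>This is the transit time \<open>f\<close> of the introduction. Only \<open>x > 0\<close>
  is meaningful: the label 0 belongs to two different leaves.\<close>

definition transit :: "real \<Rightarrow> real" where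
  "transit x = vert_time (1, x)"

lemma flow_transit: "x > 0 \<Longrightarrow> \<phi> (transit x) (x, 1) = (1, x)"
  unfolding transit_def using flow_vert_time[of "(1, x)"] by simp

lemma continuous_on_transit: "continuous_on {0<..} transit"
  unfolding transit_def by (intro continuous_on_vert_time continuous_intros) auto

lemma transit_gt:
  assumes "x > 0" "fst (\<phi> t (x, 1)) < 1"
  shows "t < transit x"
  using assms flow_less(1)[of "(x, 1)" "transit x" t] flow_transit[of x]
  by (cases t "transit x" rule: linorder_cases) auto

text \<open>The orbit of \<open>(0, 1)\<close> stays on the vertical axis. By continuity in
  \<open>x\<close>, the orbit of \<open>(x, 1)\<close> with small \<open>x > 0\<close> still has
  \<open>fst\<close> below 1 at time \<open>t\<close>, so it has not yet reached
  \<open>(1, x)\<close>.\<close>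

lemma filterlim_transit: "filterlim transit at_top (at_right 0)"
  unfolding filterlim_at_top_dense
proof
  fix t
  have "continuous_on {0..} (\<lambda>x. fst (\<phi> t (x, 1)))"
    by (intro continuous_intros continuous_on_flow) auto
  then have "((\<lambda>x. fst (\<phi> t (x, 1))) \<longlongrightarrow> fst (\<phi> t (0, 1))) (at_right 0)"
    by (auto simp: continuous_on_def intro: tendsto_within_subset)
  moreover have "fst (\<phi> t (0, 1)) = 0"
    using flow_fst_mult_snd[of "(0, 1)" t] snd_flow_pos[of "(0, 1)" t] by auto
  ultimately have "eventually (\<lambda>x. fst (\<phi> t (x, 1)) < 1) (at_right 0)"
    by (intro order_tendstoD) auto
  then show "eventually (\<lambda>x. t < transit x) (at_right 0)"
    using eventually_at_right_less[of 0] by eventually_elim (rule transit_gt)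
qed

text \<open>The two time coordinates form charts, and \<open>transit\<close> is their gluing
  function on the overlap.\<close>

lemma horiz_time_eq:
  assumes "p \<in> reeb_space" "fst p > 0" "snd p > 0"
  shows "vert_time p = horiz_time p + transit (fst p * snd p)"
proof -
  have *: "fst p * snd p > 0" using assms by simp
  have "p = \<phi> (horiz_time p) (1, fst p * snd p)" using flow_horiz_time assms by simp
  then show ?thesis
    using vert_time_flow[of "(1, fst p * snd p)" "horiz_time p"] * by (simp add: transit_def)
qed

end

interpretation reeb: reeb_like_flow reeb_flow
  by unfold_locales (rule reeb_foliation_flow_reeb_flow)

lemma reeb_transit: "x > 0 \<Longrightarrow> reeb.transit x = - ln x"
  unfolding reeb.transit_def reeb.vert_time_def by (rule reeb.travel_unique) auto

section \<open>Conjugacy and transit times\<close>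

context reeb_like_flow
begin

text \<open>The product of the coordinates separates the leaves except for the two half-axes, which
  both have product 0; \<open>side\<close> tells these apart.\<close>

lemma same_orbit:
  assumes pq: "p \<in> reeb_space" "q \<in> reeb_space" and eq: "fst p * snd p = fst q * snd q"
    and side: "snd p > 0 \<and> snd q > 0 \<or> fst p > 0 \<and> fst q > 0"
  shows "\<exists>t. \<phi> t p = q"
  using side
proof
  assume s: "snd p > 0 \<and> snd q > 0"
  let ?v = "(fst p * snd p, 1 :: real)"
  have v: "?v \<in> reeb_space" using pq by (simp add: reeb_space_iff)
  have "\<phi> (vert_time q - vert_time p) (\<phi> (vert_time p) ?v) = \<phi> (vert_time q) ?v"
    using flow_add[OF v, of "vert_time q - vert_time p" "vert_time p"] by simp
  then show ?thesis using flow_vert_time[OF pq(1)] flow_vert_time[OF pq(2)] s eq by auto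
next
  assume s: "fst p > 0 \<and> fst q > 0"
  let ?v = "(1 :: real, fst p * snd p)"
  have v: "?v \<in> reeb_space" using pq by (simp add: reeb_space_iff)
  have "\<phi> (horiz_time q - horiz_time p) (\<phi> (horiz_time p) ?v) = \<phi> (horiz_time q) ?v"
    using flow_add[OF v, of "horiz_time q - horiz_time p" "horiz_time p"] by simp
  then show ?thesis using flow_horiz_time[OF pq(1)] flow_horiz_time[OF pq(2)] s eq by auto
qed

text \<open>\<open>h\<close> is the action of \<open>g\<close> on the leaf labels. The images of the
  sections under \<open>g\<close> are curves across the leaves whose time coordinates, unlike
  \<open>transit\<close>, remain continuous at the label 0; \<open>w\<close> is the difference of
  these coordinates.\<close>

lemma rescaled_conjugacy_transit:
  assumes hom: "homeomorphism reeb_space reeb_space g g'" and c: "c > 0"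
    and conj: "\<And>t p. p \<in> reeb_space \<Longrightarrow> g (\<phi> (c * t) p) = \<phi> t (g p)"
  obtains h w where "continuous_on {0..} h" "strict_mono_on {0..} h" "h 0 = 0"
    "continuous_on {0..} w" "\<And>x. x > 0 \<Longrightarrow> transit (h x) = transit x / c + w x"
proof -
  have contg: "continuous_on reeb_space g" and gP: "p \<in> reeb_space \<Longrightarrow> g p \<in> reeb_space"
    and ginj: "p \<in> reeb_space \<Longrightarrow> q \<in> reeb_space \<Longrightarrow> g p = g q \<Longrightarrow> p = q" for p q
    using hom unfolding homeomorphism_def by (blast, blast, metis)
  have conj': "g (\<phi> t p) = \<phi> (t / c) (g p)" if "p \<in> reeb_space" for t p
    using conj[OF that, of "t / c"] c by simp
  have pull: "\<phi> (c * t) p = q" if "p \<in> reeb_space" "q \<in> reeb_space" "\<phi> t (g p) = g q" for p q t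
    using ginj[OF flow_in_space[OF that(1)] that(2)] conj that by simp
  define h where "h x = fst (g (x, 1)) * snd (g (x, 1))" for x
  have contv: "continuous_on {0..} (\<lambda>x. g (x, 1))"
    by (rule continuous_on_compose2[OF contg]) (auto intro!: continuous_intros)
  have conth': "continuous_on {0..} (\<lambda>x. g (1, x))"
    by (rule continuous_on_compose2[OF contg]) (auto intro!: continuous_intros)
  have conth: "continuous_on {0..} h" unfolding h_def by (intro continuous_intros contv)
  have g_transit: "g (1, x) = \<phi> (transit x / c) (g (x, 1))" if "x > 0" for x
    using conj'[of "(x, 1)" "transit x"] flow_transit[OF that] that by simp
  have h_horiz: "fst (g (1, x)) * snd (g (1, x)) = h x" if "x > 0" for x
    using g_transit[OF that] flow_fst_mult_snd[OF gP, of "(x, 1)"] that by (simp add: h_def)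
  have lim_right: "(f \<longlongrightarrow> f 0) (at_right 0)" if "continuous_on {0..} f"
    for f :: "real \<Rightarrow> 'z::topological_space"
    using that by (auto simp: continuous_on_def intro: tendsto_within_subset)
  have pos: "eventually (\<lambda>x::real. x > 0) (at_right 0)" by (rule eventually_at_right_less)
  txt \<open>
    The axes are the only two leaves that are not separated from each other, so that \<open>g\<close> preserves
    or exchanges them; the latter is impossible since \<open>fst\<close> increases along orbits.
  \<close>
  define A B where "A = g (0, 1)" and "B = g (1, 0)"
  have AB: "A \<in> reeb_space" "B \<in> reeb_space" unfolding A_def B_def by (auto intro: gP)
  have prodA: "h 0 = fst A * snd A" by (simp add: h_def A_def)
  \<comment> \<open>For \<open>x > 0\<close> the points \<open>g (1, x)\<close> and
    \<open>g (x, 1)\<close> lie on one orbit and share their label; the limit at 0 carries this over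
    to \<open>A\<close> and \<open>B\<close>.\<close>
  have prodB: "h 0 = fst B * snd B"
  proof (rule tendsto_unique[OF _ lim_right[OF conth]])
    have "((\<lambda>x. fst (g (1, x)) * snd (g (1, x))) \<longlongrightarrow> fst B * snd B) (at_right 0)"
      unfolding B_def by (rule lim_right) (intro continuous_intros conth')
    then show "(h \<longlongrightarrow> fst B * snd B) (at_right 0)"
      by (rule Lim_transform_eventually) (use pos h_horiz in \<open>auto elim: eventually_mono\<close>)
  qed simp
  have "\<phi> t A \<noteq> B" for t
  proof
    assume "\<phi> t A = B"
    then have "\<phi> (c * t) (0, 1) = (1, 0)" unfolding A_def B_def by (intro pull) auto
    then show False using snd_flow_pos[of "(0, 1)" "c * t"] by simp
  qed
  then have sep: "\<not> (snd A > 0 \<and> snd B > 0)" "\<not> (fst A > 0 \<and> fst B > 0)"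
    using same_orbit[OF AB] prodA prodB by auto
  have "fst B \<ge> fst A"
  proof (rule tendsto_le)
    show "((\<lambda>x. fst (g (1, x))) \<longlongrightarrow> fst B) (at_right 0)"
      unfolding B_def by (rule lim_right) (intro continuous_intros conth')
    show "((\<lambda>x. fst (g (x, 1))) \<longlongrightarrow> fst A) (at_right 0)"
      unfolding A_def by (rule lim_right) (intro continuous_intros contv)
    have "eventually (\<lambda>x. transit x > 0) (at_right 0)"
      using filterlim_transit by (auto simp: filterlim_at_top_dense)
    with pos show "eventually (\<lambda>x. fst (g (x, 1)) \<le> fst (g (1, x))) (at_right 0)"
    proof eventually_elim
      case (elim x)
      then show ?case
        using flow_less(1)[OF gP, of "(x, 1)" 0 "transit x / c"] flow_0[OF gP, of "(x, 1)"]
          g_transit[of x] c by simp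
    qed
  qed simp
  then have axes: "fst A = 0" "snd A > 0" "fst B > 0" "snd B = 0"
    using sep AB by (auto simp: reeb_space_iff)
  have h0: "h 0 = 0" using prodA axes by simp
  have nn: "h x \<ge> 0" if "x \<ge> 0" for x
    using gP[of "(x, 1)"] that by (auto simp: h_def reeb_space_iff)
  \<comment> \<open>With label 0, \<open>g (x, 1)\<close> would lie on the orbit of \<open>A\<close>
    or \<open>B\<close>, and pulling back by \<open>g\<close> would put \<open>(x, 1)\<close> on an
    axis.\<close>
  have hpos: "h x > 0" if "x > 0" for x
  proof (rule ccontr)
    let ?q = "(x, 1 :: real)"
    have q: "?q \<in> reeb_space" "g ?q \<in> reeb_space" using that gP by auto
    assume "\<not> h x > 0"
    then have h: "fst (g ?q) * snd (g ?q) = 0" using nn[of x] that by (simp add: h_def)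
    have no: "\<phi> t p \<noteq> ?q" if "p \<in> reeb_space" "fst p * snd p = 0" for t p
      using flow_fst_mult_snd[OF that(1), of t] that(2) \<open>x > 0\<close> by auto
    have "(\<exists>t. \<phi> t A = g ?q) \<or> (\<exists>t. \<phi> t B = g ?q)"
      using same_orbit[OF AB(1) q(2)] same_orbit[OF AB(2) q(2)] h axes q(2)
      by (simp add: reeb_space_iff) auto
    then show False
      using pull[OF _ q(1), of "(0, 1)"] pull[OF _ q(1), of "(1, 0)"] no unfolding A_def B_def
      by fastforce
  qed
  have sndpos: "g (x, 1) \<in> reeb_space \<and> snd (g (x, 1)) > 0" if "x \<ge> 0" for x
    using hpos[of x] axes that gP[of "(x, 1)"]
    by (cases "x = 0") (auto simp: A_def h_def zero_less_mult_iff reeb_space_iff)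
  have hinj: "x = y" if xy: "x > 0" "y > 0" "h x = h y" for x y
  proof -
    have "\<exists>t. \<phi> t (g (x, 1)) = g (y, 1)"
      using same_orbit[of "g (x, 1)" "g (y, 1)"] sndpos[of x] sndpos[of y] that by (simp add: h_def)
    then obtain t where "\<phi> (c * t) (x, 1) = (y, 1)" using pull[of "(x, 1)" "(y, 1)"] xy by auto
    then show ?thesis using flow_fst_mult_snd[of "(x, 1)" "c * t"] that by simp
  qed
  have "strict_mono_on {0..} h"
  proof (rule strict_mono_onI)
    fix x y :: real assume xy: "x \<in> {0..}" "y \<in> {0..}" "x < y"
    show "h x < h y"
    proof (cases "x = 0")
      case False
      have "inj_on h {0..y}" using hinj hpos h0 by (metis atLeastAtMost_iff inj_onI order_le_less)
      then have "h 0 < h x \<and> h x < h y \<or> h y < h x \<and> h x < h 0"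
        using continuous_inj_imp_mono[of 0 x y h] False xy conth continuous_on_subset[of "{0..}" h "{0..y}"] by auto
      then show ?thesis using h0 nn[of x] xy by auto
    qed (use h0 hpos xy in auto)
  qed
  moreover
  have fstpos: "g (1, x) \<in> reeb_space \<and> fst (g (1, x)) > 0" if "x \<ge> 0" for x
  proof (cases "x = 0")
    case False
    then have "fst (g (1, x)) * snd (g (1, x)) > 0" using hpos[of x] h_horiz[of x] that by simp
    then have "fst (g (1, x)) \<noteq> 0" by auto
    then show ?thesis using gP[of "(1, x)"] that by (simp add: reeb_space_iff)
  qed (use axes AB in \<open>simp add: B_def\<close>)
  have "continuous_on {0..} (\<lambda>x. vert_time (g (x, 1)) - horiz_time (g (1, x)))"
    using sndpos fstpos
    by (intro continuous_intros continuous_on_vert_time continuous_on_horiz_time contv conth') auto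
  moreover have "transit (h x) = transit x / c + (vert_time (g (x, 1)) - horiz_time (g (1, x)))"
    if x: "x > 0" for x
  proof -
    have q: "g (x, 1) \<in> reeb_space" "snd (g (x, 1)) > 0" using sndpos x by auto
    have "snd (g (1, x)) > 0" using g_transit[OF x] snd_flow_pos[OF q] by simp
    \<comment> \<open>The vertical time of \<open>g (1, x)\<close> is computed twice: from its
      horizontal time and along the orbit from \<open>g (x, 1)\<close>.\<close>
    then have "vert_time (g (1, x)) = horiz_time (g (1, x)) + transit (h x)"
      using horiz_time_eq[of "g (1, x)"] fstpos[of x] h_horiz[OF x] x by simp
    moreover have "vert_time (g (1, x)) = transit x / c + vert_time (g (x, 1))"
      using vert_time_flow[OF q] g_transit[OF x] by simp
    ultimately show ?thesis by simp
  qed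
  ultimately show ?thesis using that conth h0 by blast
qed

end

section \<open>Building conjugacies from transit times\<close>

text \<open>A semiconjugacy together with its values on both sections. These determine
  \<open>G\<close>, since every orbit meets a section; \<open>w\<close> is the time shift on
  \<open>x = 1\<close>.\<close>

definition section_conjugacy ::
  "(real \<Rightarrow> real \<times> real \<Rightarrow> real \<times> real) \<Rightarrow> (real \<Rightarrow> real \<times> real \<Rightarrow> real \<times> real) \<Rightarrow>
    (real \<Rightarrow> real) \<Rightarrow> (real \<Rightarrow> real) \<Rightarrow> (real \<times> real \<Rightarrow> real \<times> real) \<Rightarrow> bool" where
  "section_conjugacy \<phi> \<psi> k w G \<longleftrightarrow>
     continuous_on reeb_space G \<and> (\<forall>p\<in>reeb_space. G p \<in> reeb_space) \<and>
     (\<forall>t. \<forall>p\<in>reeb_space. G (\<phi> t p) = \<psi> t (G p)) \<and>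
     (\<forall>x\<ge>0. G (x, 1) = (k x, 1) \<and> G (1, x) = \<psi> (w x) (1, k x))"

text \<open>\<open>Gv\<close> and \<open>Gh\<close> extend the prescribed values along the flow from
  the two sections. The relation between the transit times makes them agree where they overlap, and
  their domains are open in \<open>reeb_space\<close>.\<close>

lemma section_conjugacy_exists:
  assumes "reeb_like_flow \<phi>" "reeb_like_flow \<psi>"
    and k: "continuous_on {0..} k" "k 0 = 0" "\<And>x. x > 0 \<Longrightarrow> k x > 0"
    and w: "continuous_on {0..} w"
    and transit: "\<And>x. x > 0 \<Longrightarrow> reeb_like_flow.transit \<phi> x = reeb_like_flow.transit \<psi> (k x) + w x"
  shows "\<exists>G. section_conjugacy \<phi> \<psi> k w G"
proof -
  interpret A: reeb_like_flow \<phi> by fact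
  interpret B: reeb_like_flow \<psi> by fact
  have k0: "k x \<ge> 0" if "x \<ge> 0" for x using k(2) k(3)[of x] that by (cases "x = 0") auto
  define Gv where "Gv p = \<psi> (A.vert_time p) (k (fst p * snd p), 1)" for p
  define Gh where "Gh p = \<psi> (A.horiz_time p + w (fst p * snd p)) (1, k (fst p * snd p))" for p
  define G where "G p = (if snd p > 0 then Gv p else Gh p)" for p
  have Gh: "G p = Gh p" if p: "p \<in> reeb_space" "fst p > 0" for p
  proof (cases "snd p > 0")
    case True
    let ?x = "fst p * snd p"
    have x: "?x > 0" using True p by simp
    have "Gv p = \<psi> (A.horiz_time p + w ?x + B.transit (k ?x)) (k ?x, 1)"
      using A.horiz_time_eq[OF p True] transit[OF x] by (simp add: Gv_def add_ac)
    also have "\<dots> = Gh p"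
      using B.flow_add[of "(k ?x, 1)"] B.flow_transit[OF k(3)[OF x]] k0[of ?x] x by (simp add: Gh_def)
    finally show ?thesis using True by (simp add: G_def)
  qed (simp add: G_def)
  let ?V = "{p \<in> reeb_space. snd p > 0}" and ?H = "{p \<in> reeb_space. fst p > 0}"
  have union: "reeb_space = ?V \<union> ?H" by (auto simp: reeb_space_iff)
  have prod: "fst p * snd p \<ge> 0" if "p \<in> reeb_space" for p using that by (simp add: reeb_space_iff)
  have "continuous_on ?V Gv" unfolding Gv_def
    by (intro B.continuous_on_flow A.continuous_on_vert_time continuous_intros
        continuous_on_compose2[OF k(1)]) (auto simp: reeb_space_iff k0)
  then have contV: "continuous_on ?V G" by (rule continuous_on_eq) (simp add: G_def)
  have "continuous_on ?H Gh" unfolding Gh_def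
    by (intro B.continuous_on_flow A.continuous_on_horiz_time continuous_intros
        continuous_on_compose2[OF k(1)] continuous_on_compose2[OF w]) (auto simp: reeb_space_iff k0)
  then have contH: "continuous_on ?H G" by (rule continuous_on_eq) (simp add: Gh)
  have "openin (top_of_set reeb_space) ?V" "openin (top_of_set reeb_space) ?H"
    using openin_open_Int[of "{p :: real \<times> real. snd p > 0}" reeb_space]
      openin_open_Int[of "{p :: real \<times> real. fst p > 0}" reeb_space]
    by (auto simp: Collect_conj_eq open_Collect_less continuous_intros)
  then have "continuous_on reeb_space G"
    using continuous_on_Un_local_open[of ?V ?H G] contV contH union by simp
  moreover have "G p \<in> reeb_space" if p: "p \<in> reeb_space" for p
    unfolding G_def Gv_def Gh_def using k0[OF prod[OF p]] by (simp add: B.flow_in_space)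
  moreover have "G (\<phi> t p) = \<psi> t (G p)" if p: "p \<in> reeb_space" for t p
  proof (cases "snd p > 0")
    case True
    then show ?thesis
      using A.snd_flow_pos[OF p True, of t] A.flow_fst_mult_snd[OF p, of t] A.vert_time_flow[OF p True, of t]
        k0[OF prod[OF p]] B.flow_add[of "(k (fst p * snd p), 1)" t "A.vert_time p"]
      by (simp add: G_def Gv_def)
  next
    case False
    then have f: "fst p > 0" using p by (auto simp: reeb_space_iff)
    show ?thesis
      using Gh[OF p f] Gh[OF A.flow_in_space[OF p] A.fst_flow_pos[OF p f], of t]
        A.flow_fst_mult_snd[OF p, of t] A.horiz_time_flow[OF p f, of t]
        k0[OF prod[OF p]]
        B.flow_add[of "(1, k (fst p * snd p))" t "A.horiz_time p + w (fst p * snd p)"]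
      by (simp add: Gh_def add.assoc)
  qed
  moreover have "G (x, 1) = (k x, 1)" "G (1, x) = \<psi> (w x) (1, k x)" if "x \<ge> 0" for x
    using that B.flow_0[of "(k x, 1)"] k0[OF that] Gh[of "(1, x)"]
    by (simp_all add: G_def[of "(x, 1)"] Gv_def Gh_def)
  ultimately show ?thesis unfolding section_conjugacy_def by blast
qed

text \<open>\<open>G' \<circ> G\<close> commutes with \<phi> and fixes the points of both sections,
  the shift \<open>w x\<close> being undone by \<open>- w x\<close>; every orbit meets a
  section.\<close>

lemma section_conjugacy_left_inverse:
  assumes "reeb_like_flow \<phi>" "reeb_like_flow \<psi>"
    and G: "section_conjugacy \<phi> \<psi> k w G" and G': "section_conjugacy \<psi> \<phi> k' w' G'"
    and inv: "\<And>x. x \<ge> 0 \<Longrightarrow> k x \<ge> 0 \<and> k' (k x) = x \<and> w' (k x) = - w x"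
    and p: "p \<in> reeb_space"
  shows "G' (G p) = p"
proof -
  interpret A: reeb_like_flow \<phi> by fact
  interpret B: reeb_like_flow \<psi> by fact
  define x where "x = fst p * snd p"
  have x: "x \<ge> 0" using p by (simp add: x_def reeb_space_iff)
  note i = inv[OF x]
  have P: "(x, 1) \<in> reeb_space" "(1, x) \<in> reeb_space" "(k x, 1) \<in> reeb_space" "(1, k x) \<in> reeb_space"
    using x i by auto
  have conj: "G (\<phi> t q) = \<psi> t (G q)" "G' (\<psi> t q) = \<phi> t (G' q)" if "q \<in> reeb_space" for t q
    using G G' that unfolding section_conjugacy_def by blast+
  have sec: "G (x, 1) = (k x, 1)" "G (1, x) = \<psi> (w x) (1, k x)"
    "G' (k x, 1) = (x, 1)" "G' (1, k x) = \<phi> (- w x) (1, x)"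
    using G G' x i unfolding section_conjugacy_def by auto
  show ?thesis
  proof (cases "snd p > 0")
    case True
    have "p = \<phi> (A.vert_time p) (x, 1)" using A.flow_vert_time[OF p True] by (simp add: x_def)
    then show ?thesis using conj(1)[OF P(1)] conj(2)[OF P(3)] sec by metis
  next
    case False
    then have "fst p > 0" using p by (auto simp: reeb_space_iff)
    then obtain t where t: "p = \<phi> t (1, x)" using A.flow_horiz_time[OF p] by (metis x_def)
    have "G p = \<psi> t (\<psi> (w x) (1, k x))" using conj(1)[OF P(2)] sec t by simp
    also have "\<dots> = \<psi> (t + w x) (1, k x)" using B.flow_add[OF P(4)] by simp
    finally have "G' (G p) = \<phi> (t + w x) (\<phi> (- w x) (1, x))" using conj(2)[OF P(4)] sec by simp
    also have "\<dots> = p" using A.flow_add[OF P(2), of "t + w x" "- w x"] t by simp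
    finally show ?thesis .
  qed
qed

lemma conjugate_if_transits_agree:
  assumes \<phi>: "reeb_like_flow \<phi>" and \<psi>: "reeb_like_flow \<psi>"
    and k: "homeomorphism {0..} {0..} k k'" "k 0 = 0"
    and w: "continuous_on {0..} w"
    and transit: "\<And>x. x > 0 \<Longrightarrow> reeb_like_flow.transit \<phi> x = reeb_like_flow.transit \<psi> (k x) + w x"
  shows "topologically_conjugate_on reeb_space \<phi> \<psi>"
proof -
  have contk: "continuous_on {0..} k" "continuous_on {0..} k'"
    and inv: "\<And>x. x \<ge> 0 \<Longrightarrow> k x \<ge> 0 \<and> k' (k x) = x" "\<And>y. y \<ge> 0 \<Longrightarrow> k' y \<ge> 0 \<and> k (k' y) = y"
    using k(1) unfolding homeomorphism_def by auto
  have k'0: "k' 0 = 0" using inv(1)[of 0] k(2) by simp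
  have kpos: "k x > 0" if "x > 0" for x using inv(1)[of x] k'0 that by (metis order_le_less)
  have k'pos: "k' y > 0" if "y > 0" for y using inv(2)[of y] k(2) that by (metis order_le_less)
  \<comment> \<open>This comes from solving the relation at \<open>x = k' y\<close> for the transit
    time of \<psi>.\<close>
  define w' where "w' y = - w (k' y)" for y
  have w': "continuous_on {0..} w'" unfolding w'_def
    by (intro continuous_intros continuous_on_compose2[OF w contk(2)]) (use inv in auto)
  obtain G where G: "section_conjugacy \<phi> \<psi> k w G"
    using section_conjugacy_exists[OF \<phi> \<psi> contk(1) k(2) kpos w transit] by blast
  have "reeb_like_flow.transit \<psi> y = reeb_like_flow.transit \<phi> (k' y) + w' y" if "y > 0" for y
    using transit[OF k'pos[OF that]] inv(2)[of y] that by (simp add: w'_def)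
  then obtain G' where G': "section_conjugacy \<psi> \<phi> k' w' G'"
    using section_conjugacy_exists[OF \<psi> \<phi> contk(2) k'0 k'pos w'] by blast
  have "G' (G p) = p" if "p \<in> reeb_space" for p
    using section_conjugacy_left_inverse[OF \<phi> \<psi> G G' _ that] inv(1) by (simp add: w'_def)
  moreover have "G (G' p) = p" if "p \<in> reeb_space" for p
    using section_conjugacy_left_inverse[OF \<psi> \<phi> G' G _ that] inv(2) by (simp add: w'_def)
  ultimately have "homeomorphism reeb_space reeb_space G G'"
    using G G' unfolding section_conjugacy_def by (intro homeomorphismI) auto
  then show ?thesis using G unfolding topologically_conjugate_on_def section_conjugacy_def by blast
qed

section \<open>Almost monotone transit times\<close>

lemma continuous_on_extend_by_limit:
  fixes f :: "real \<Rightarrow> 'a::topological_space"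
  assumes cont: "continuous_on {0<..} f" and lim: "(f \<longlongrightarrow> c) (at_right 0)"
  shows "continuous_on {0..} (\<lambda>x. if x = 0 then c else f x)"
  unfolding continuous_on_def
proof
  fix x :: real assume "x \<in> {0..}"
  then consider "x = 0" | "x > 0" by force
  then show "((\<lambda>x. if x = 0 then c else f x) \<longlongrightarrow> (if x = 0 then c else f x)) (at x within {0..})"
  proof cases
    case 1
    have "((\<lambda>x. if x = 0 then c else f x) \<longlongrightarrow> c) (at_right 0)"
      by (rule Lim_transform_eventually[OF lim]) (auto simp: eventually_at_filter)
    moreover have "at 0 within {0..} = at_right (0::real)"
      unfolding at_within_def by (intro arg_cong2[where f = inf] arg_cong[where f = principal]) auto
    ultimately show ?thesis using 1 by simp
  next
    case 2
    have "isCont f x" using cont 2 by (simp add: continuous_on_eq_continuous_at)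
    then have "(f \<longlongrightarrow> f x) (at x)" by (simp add: isCont_def)
    moreover have "eventually (\<lambda>y. f y = (if y = 0 then c else f y)) (at x)"
      by (rule eventually_mono[OF eventually_at_in_open'[of "{0<..}" x]]) (use 2 in auto)
    ultimately have "((\<lambda>x. if x = 0 then c else f x) \<longlongrightarrow> f x) (at x)"
      by (rule Lim_transform_eventually)
    then show ?thesis using 2 by (auto intro: tendsto_within_subset)
  qed
qed

lemma filterlim_minus_ln_at_right_0: "filterlim (\<lambda>x::real. - ln x) at_top (at_right 0)"
  using ln_at_0 by (simp add: filterlim_uminus_at_top)

lemma filterlim_exp_minus_max: "filterlim (\<lambda>s::real. exp (- max 0 s)) (at_right 0) at_top"
proof -
  have "filterlim (\<lambda>s::real. max 0 s) at_top at_top"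
    by (rule filterlim_at_top_mono[OF filterlim_ident]) auto
  then have "((\<lambda>s::real. exp (- max 0 s)) \<longlongrightarrow> 0) at_top"
    by (intro filterlim_compose[OF exp_at_bot]) (simp add: filterlim_uminus_at_top)
  then show ?thesis by (simp add: filterlim_at)
qed

text \<open>The summand \<open>x\<close> makes \<open>k\<close> strictly increasing and does not matter as \<open>x\<close> tends to 0.\<close>

lemma homeomorphism_from_eventually_mono:
  fixes M :: "real \<Rightarrow> real"
  assumes cont: "continuous_on UNIV M" and mono: "mono_on {s0..} M" and lim: "filterlim M at_top at_top"
  defines "k \<equiv> \<lambda>x. if x = 0 then 0 else exp (x - M (max s0 (- ln x)))"
  shows "\<exists>k'. homeomorphism {0..} {0..} k k'"
proof (rule homeomorphism_into_1d)
  have max_lim: "filterlim (\<lambda>x. max s0 (- ln x)) at_top (at_right 0)"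
    by (rule filterlim_at_top_mono[OF filterlim_minus_ln_at_right_0]) auto
  have "((\<lambda>x::real. - x) \<longlongrightarrow> - 0) (at_right 0)" by (intro tendsto_intros)
  then have "filterlim (\<lambda>x. - x + M (max s0 (- ln x))) at_top (at_right 0)"
    by (rule filterlim_tendsto_add_at_top) (rule filterlim_compose[OF lim max_lim])
  then have "filterlim (\<lambda>x. x - M (max s0 (- ln x))) at_bot (at_right 0)"
    by (simp add: filterlim_uminus_at_top add.commute)
  then have lim0: "((\<lambda>x. exp (x - M (max s0 (- ln x)))) \<longlongrightarrow> 0) (at_right 0)"
    by (rule filterlim_compose[OF exp_at_bot])
  have "continuous_on {0<..} (\<lambda>x. M (max s0 (- ln x)))"
    by (rule continuous_on_compose2[OF cont]) (auto intro!: continuous_intros)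
  then show contk: "continuous_on {0..} k"
    unfolding k_def by (intro continuous_on_extend_by_limit lim0 continuous_intros)
  \<comment> \<open>Clamping at \<open>s0\<close> keeps the arguments in the range where
    \<open>M\<close> is monotone.\<close>
  have less: "k x < k y" if "0 \<le> x" "x < y" for x y
  proof (cases "x = 0")
    case False
    have "- ln y < - ln x" using that False by simp
    then have "M (max s0 (- ln y)) \<le> M (max s0 (- ln x))" by (intro mono_onD[OF mono]) auto
    then show ?thesis using that False by (simp add: k_def)
  qed (use that in \<open>simp add: k_def\<close>)
  then show "inj_on k {0..}"
    by (metis atLeast_iff linorder_inj_onI' order_less_irrefl)
  have k0: "k 0 = 0" by (simp add: k_def)
  show "k ` {0..} = {0..}"
  proof
    show "k ` {0..} \<subseteq> {0..}" by (auto simp: k_def)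
    show "{0..} \<subseteq> k ` {0..}"
    proof
      fix z :: real assume z: "z \<in> {0..}"
      \<comment> \<open>The first entry puts \<open>- ln X\<close> at or below \<open>s0\<close>, so
        that \<open>k X = exp (X - M s0)\<close>; the second makes this at least
        \<open>z + 1\<close>.\<close>
      define X where "X = max (exp (- s0)) (ln (z + 1) + M s0)"
      have X: "X > 0" "X \<ge> exp (- s0)" "X - M s0 \<ge> ln (z + 1)"
        using less_le_trans[of 0 "exp (- s0)" X] by (auto simp: X_def)
      have "max s0 (- ln X) = s0" using X(1,2) ln_ge_iff[of X "- s0"] by simp
      then have "k X = exp (X - M s0)" using X(1) by (simp add: k_def)
      also have "\<dots> \<ge> exp (ln (z + 1))" using X(3) by simp
      finally have "z \<le> k X" using z by simp
      then show "z \<in> k ` {0..}"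
        using IVT'[of k 0 z X] z X(1) continuous_on_subset[OF contk, of "{0..X}"] k0 by auto
    qed
  qed
qed (simp add: convex_imp_path_connected)

context reeb_like_flow
begin

text \<open>By the choice of \<open>k\<close>, the standard transit time \<open>- ln (k x)\<close>
  equals \<open>M (max s0 (- ln x)) - x\<close>. What remains of \<open>transit x\<close> is
  \<open>w x\<close>, which by \<open>diff\<close> extends continuously to 0.\<close>

lemma conjugate_reeb_flow_if_almost_monotone:
  assumes M: "continuous_on UNIV M" "mono_on {s0..} M" "filterlim M at_top at_top"
    and diff: "((\<lambda>s. transit (exp (- s)) - M s) \<longlongrightarrow> c) at_top"
  shows "topologically_conjugate_on reeb_space \<phi> reeb_flow"
proof -
  define k where "k x = (if x = 0 then 0 else exp (x - M (max s0 (- ln x))))" for x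
  define w where "w x = (if x = 0 then c else transit x + (x - M (max s0 (- ln x))))" for x
  obtain k' where k': "homeomorphism {0..} {0..} k k'"
    using homeomorphism_from_eventually_mono[OF M] unfolding k_def by blast
  have "continuous_on {0<..} (\<lambda>x. M (max s0 (- ln x)))"
    by (rule continuous_on_compose2[OF M(1)]) (auto intro!: continuous_intros)
  then have cont: "continuous_on {0<..} (\<lambda>x. transit x + (x - M (max s0 (- ln x))))"
    by (intro continuous_intros continuous_on_transit)
  have "((\<lambda>x. (transit (exp (- (- ln x))) - M (- ln x)) + x) \<longlongrightarrow> c + 0) (at_right 0)"
    by (intro tendsto_add filterlim_compose[OF diff] filterlim_minus_ln_at_right_0 tendsto_ident_at)
  moreover have "eventually (\<lambda>x. (transit (exp (- (- ln x))) - M (- ln x)) + x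
      = transit x + (x - M (max s0 (- ln x)))) (at_right 0)"
  proof -
    have "eventually (\<lambda>x::real. - ln x \<ge> s0) (at_right 0)"
      using filterlim_minus_ln_at_right_0 by (auto simp: filterlim_at_top)
    with eventually_at_right_less show ?thesis by eventually_elim (simp add: max_def)
  qed
  ultimately have "((\<lambda>x. transit x + (x - M (max s0 (- ln x)))) \<longlongrightarrow> c) (at_right 0)"
    using Lim_transform_eventually by fastforce
  then have contw: "continuous_on {0..} w"
    unfolding w_def using cont by (intro continuous_on_extend_by_limit)
  have "transit x = reeb.transit (k x) + w x" if "x > 0" for x
    using that reeb_transit[of "k x"] by (simp add: k_def w_def)
  moreover have "k 0 = 0" by (simp add: k_def)
  ultimately show ?thesis
    using conjugate_if_transits_agree[OF _ _ k' _ contw] reeb_like_flow_axioms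
      reeb.reeb_like_flow_axioms by blast
qed

text \<open>For large \<open>s\<close>, \<open>H\<close> is the label map \<open>h\<close> of the
  conjugacy in the coordinate \<open>s = - ln x\<close>. Slowing time by \<open>l\<close> multiplies
  transit times by \<open>l\<close>, and the error \<open>w\<close> converges because it is
  continuous at 0.\<close>

lemma rescaled_conjugacy_log_transit:
  fixes l :: real
  defines "F \<equiv> \<lambda>s. transit (exp (- max 0 s))"
  assumes l: "l > 0" and conj: "topologically_conjugate_on reeb_space (\<lambda>t. \<phi> (t / l)) \<phi>"
  shows "\<exists>H c. continuous_on UNIV H \<and> mono H \<and> H 0 = 0 \<and> filterlim H at_top at_top \<and>
    ((\<lambda>s. F (H s) - l * F s) \<longlongrightarrow> c) at_top"
proof -
  obtain g g' where g: "homeomorphism reeb_space reeb_space g g'"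
    "\<And>t p. p \<in> reeb_space \<Longrightarrow> g (\<phi> (1 / l * t) p) = \<phi> t (g p)"
    using conj unfolding topologically_conjugate_on_def by auto
  obtain h w where h: "continuous_on {0..} h" "strict_mono_on {0..} h" "h 0 = 0"
    and w: "continuous_on {0..} w" and hw: "\<And>x. x > 0 \<Longrightarrow> transit (h x) = transit x / (1 / l) + w x"
    using rescaled_conjugacy_transit[OF g(1) _ g(2)] l by auto
  have hpos: "h x > 0" if "x > 0" for x using strict_mono_onD[OF h(2), of 0 x] h(3) that by simp
  define u where "u s = exp (- max 0 s)" for s :: real
  have u: "u s > 0" for s by (simp add: u_def)
  have contu: "continuous_on UNIV u" unfolding u_def by (intro continuous_intros)
  have ulim: "filterlim u (at_right 0) at_top"
    unfolding u_def by (rule filterlim_exp_minus_max)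
  have lim0: "(f \<longlongrightarrow> f 0) (at_right 0)" if "continuous_on {0..} f" for f :: "real \<Rightarrow> real"
    using that by (auto simp: continuous_on_def intro: tendsto_within_subset)
  have "eventually (\<lambda>s. h (u s) > 0) at_top" using hpos u by simp
  moreover have "((\<lambda>s. h (u s)) \<longlongrightarrow> 0) at_top"
    using filterlim_compose[OF lim0[OF h(1)] ulim] h(3) by simp
  ultimately have "filterlim (\<lambda>s. h (u s)) (at_right 0) at_top"
    by (auto simp: filterlim_at elim: eventually_mono)
  then have hlim: "filterlim (\<lambda>s. - ln (h (u s))) at_top at_top"
    by (rule filterlim_compose[OF filterlim_minus_ln_at_right_0])
  txt \<open>The first factor enforces \<open>H 0 = 0\<close> and is 1 for large \<open>s\<close>.\<close>
  define H where "H s = min 1 (max 0 s) * max 0 (- ln (h (u s)))" for s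
  have "continuous_on UNIV (\<lambda>s. h (u s))"
    by (rule continuous_on_compose2[OF h(1) contu]) (use u in \<open>auto intro: less_imp_le\<close>)
  then have "continuous_on UNIV H"
    unfolding H_def using hpos u by (intro continuous_intros) (auto simp: less_imp_neq[THEN not_sym])
  moreover have "mono H"
  proof
    fix s t :: real assume st: "s \<le> t"
    have "u t \<le> u s" using st by (simp add: u_def)
    then have "h (u t) \<le> h (u s)"
      using strict_mono_on_imp_mono_on[OF h(2)] u by (auto simp: mono_on_def less_imp_le)
    then have "- ln (h (u s)) \<le> - ln (h (u t))" using hpos u by simp
    then show "H s \<le> H t" unfolding H_def using st by (intro mult_mono) auto
  qed
  moreover have "H 0 = 0" by (simp add: H_def)
  moreover have large: "eventually (\<lambda>s. H s = - ln (h (u s)) \<and> H s \<ge> 0 \<and> s \<ge> 1) at_top"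
  proof -
    have "eventually (\<lambda>s. - ln (h (u s)) \<ge> 0) at_top" using hlim unfolding filterlim_at_top by blast
    with eventually_ge_at_top[of 1] show ?thesis by eventually_elim (simp add: H_def)
  qed
  moreover have "filterlim H at_top at_top"
    by (rule filterlim_mono_eventually[OF hlim order_refl order_refl])
      (use large in \<open>auto elim: eventually_mono\<close>)
  moreover have "((\<lambda>s. F (H s) - l * F s) \<longlongrightarrow> w 0) at_top"
  proof (rule Lim_transform_eventually[OF filterlim_compose[OF lim0[OF w] ulim]])
    show "eventually (\<lambda>s. w (u s) = F (H s) - l * F s) at_top"
      using large
    proof eventually_elim
      case (elim s)
      then have "max 0 (H s) = - ln (h (u s))" by linarith
      then have "F (H s) = transit (h (u s))" using hpos[OF u[of s]] by (simp add: F_def)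
      also have "\<dots> = l * F s + w (u s)" using hw[OF u[of s]] by (simp add: F_def u_def)
      finally show ?case by simp
    qed
  qed
  ultimately show ?thesis by blast
qed

end

section \<open>Conjugacy and rescaling\<close>

lemma topologically_conjugate_on_trans:
  assumes "topologically_conjugate_on S \<phi> \<psi>" "topologically_conjugate_on S \<psi> \<theta>"
  shows "topologically_conjugate_on S \<phi> \<theta>"
proof -
  obtain g g' where g: "homeomorphism S S g g'" "\<And>t p. p \<in> S \<Longrightarrow> g (\<phi> t p) = \<psi> t (g p)"
    using assms(1) unfolding topologically_conjugate_on_def by blast
  obtain h h' where h: "homeomorphism S S h h'" "\<And>t p. p \<in> S \<Longrightarrow> h (\<psi> t p) = \<theta> t (h p)"
    using assms(2) unfolding topologically_conjugate_on_def by blast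
  have "(h \<circ> g) (\<phi> t p) = \<theta> t ((h \<circ> g) p)" if "p \<in> S" for t p
    using g h that unfolding homeomorphism_def by fastforce
  then show ?thesis
    unfolding topologically_conjugate_on_def using homeomorphism_compose[OF g(1) h(1)] by blast
qed

lemma topologically_conjugate_on_sym:
  assumes conj: "topologically_conjugate_on S \<phi> \<psi>" and inv: "\<And>t p. p \<in> S \<Longrightarrow> \<phi> t p \<in> S"
  shows "topologically_conjugate_on S \<psi> \<phi>"
proof -
  obtain g g' where g: "homeomorphism S S g g'" "\<And>t p. p \<in> S \<Longrightarrow> g (\<phi> t p) = \<psi> t (g p)"
    using conj unfolding topologically_conjugate_on_def by blast
  have "g' (\<psi> t p) = \<phi> t (g' p)" if "p \<in> S" for t p
  proof -
    have p: "g' p \<in> S" "g (g' p) = p" using g(1) that unfolding homeomorphism_def by auto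
    then have "\<psi> t p = g (\<phi> t (g' p))" using g(2) by simp
    then show ?thesis using homeomorphism_apply1[OF g(1) inv[OF p(1)]] by simp
  qed
  then show ?thesis
    unfolding topologically_conjugate_on_def using homeomorphism_symD[OF g(1)] by blast
qed

lemma topologically_conjugate_on_rescale:
  assumes "topologically_conjugate_on S \<phi> \<psi>"
  shows "topologically_conjugate_on S (\<lambda>t. \<phi> (c * t)) (\<lambda>t. \<psi> (c * t))"
  using assms unfolding topologically_conjugate_on_def by blast

text \<open>Raising both coordinates to the power \<open>1 / c\<close> turns the factor
  \<open>exp (c * t)\<close> into \<open>exp t\<close>. Since \<open>0 powr a = 0\<close>, the axes
  are preserved, and positive exponents give continuity there.\<close>

lemma reeb_flow_rescale_conjugate:
  assumes c: "c > 0"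
  shows "topologically_conjugate_on reeb_space (\<lambda>t. reeb_flow (c * t)) reeb_flow"
proof -
  define pw where "pw a p = (fst p powr a, snd p powr a)" for a :: real and p :: "real \<times> real"
  have cont: "continuous_on reeb_space (pw a)" if "a > 0" for a
    unfolding pw_def using that
    by (intro continuous_intros continuous_on_powr') (auto simp: reeb_space_iff)
  have range: "pw a p \<in> reeb_space" if "p \<in> reeb_space" for a p
    using that by (auto simp: pw_def reeb_space_iff)
  have inv: "pw a (pw b p) = p" if "p \<in> reeb_space" "a * b = 1" for a b p
    using that by (auto simp: pw_def reeb_space_iff powr_powr mult.commute prod_eq_iff)
  have "homeomorphism reeb_space reeb_space (pw (1 / c)) (pw c)"
    using c by (intro homeomorphismI cont) (auto simp: range inv)
  moreover have "pw (1 / c) (reeb_flow (c * t) p) = reeb_flow t (pw (1 / c) p)" if "p \<in> reeb_space" for t p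
    using that c by (simp add: pw_def reeb_flow_def reeb_space_iff powr_mult exp_powr_real)
  ultimately show ?thesis unfolding topologically_conjugate_on_def by blast
qed

theorem theorem1:
  fixes \<phi> :: "real \<Rightarrow> real \<times> real \<Rightarrow> real \<times> real"
  assumes "reeb_foliation_flow \<phi>"
  shows "topologically_conjugate_on reeb_space \<phi> reeb_flow \<longleftrightarrow>
    (\<forall>c>0. topologically_conjugate_on reeb_space (\<lambda>t. \<phi> (c * t)) \<phi>)"
proof
  interpret reeb_like_flow \<phi> by unfold_locales fact
  {
    assume conj: "topologically_conjugate_on reeb_space \<phi> reeb_flow"
    show "\<forall>c>0. topologically_conjugate_on reeb_space (\<lambda>t. \<phi> (c * t)) \<phi>"
    proof (intro allI impI)
      fix c :: real assume "c > 0"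
      \<comment> \<open>The chain runs from the rescaled \<phi> to the rescaled standard flow, to
        the standard flow, and back to \<phi>.\<close>
      then show "topologically_conjugate_on reeb_space (\<lambda>t. \<phi> (c * t)) \<phi>"
        by (intro topologically_conjugate_on_trans[OF topologically_conjugate_on_rescale[OF conj]]
            topologically_conjugate_on_trans[OF reeb_flow_rescale_conjugate]
            topologically_conjugate_on_sym[OF conj] flow_in_space)
    qed
  next
    assume all: "\<forall>c>0. topologically_conjugate_on reeb_space (\<lambda>t. \<phi> (c * t)) \<phi>"
    define F where "F s = transit (exp (- max 0 s))" for s
    have cont: "continuous_on UNIV F"
      unfolding F_def
      by (rule continuous_on_compose2[OF continuous_on_transit]) (auto intro!: continuous_intros)
    have lim: "filterlim F at_top at_top"
      unfolding F_def
      by (rule filterlim_compose[OF filterlim_transit filterlim_exp_minus_max])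
    have "\<exists>H c. continuous_on UNIV H \<and> mono H \<and> H 0 = 0 \<and> filterlim H at_top at_top \<and>
        ((\<lambda>s. F (H s) - l * F s) \<longlongrightarrow> c) at_top" if "1 \<le> l" for l
    proof -
      have "topologically_conjugate_on reeb_space (\<lambda>t. \<phi> (t / l)) \<phi>"
        using all[rule_format, of "1 / l"] that by simp
      from rescaled_conjugacy_log_transit[OF _ this] show ?thesis
        unfolding F_def using that by simp
    qed
    from eventually_mono_perturbation[OF cont lim this]
    obtain M s0 c where M: "continuous_on UNIV M" "mono_on {s0..} M" "filterlim M at_top at_top"
      and diff: "((\<lambda>s. F s - M s) \<longlongrightarrow> c) at_top"
      by blast
    have "((\<lambda>s. transit (exp (- s)) - M s) \<longlongrightarrow> c) at_top"
      by (rule Lim_transform_eventually[OF diff])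
        (use eventually_ge_at_top[of 0] in eventually_elim, simp add: F_def)
    then show "topologically_conjugate_on reeb_space \<phi> reeb_flow"
      by (rule conjugate_reeb_flow_if_almost_monotone[OF M])
  }
qed

end
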